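(* Let $K\subset\mathbb{R}^n$ be a nonempty closed convex set and let $P:\mathbb{R}^n\to\mathbb{R}^n$ be a polynomial map of degree $d$, where $d$ is a positive integer. Consider the following statements: (a) $(K,P)$ is an $R_0$-pair; (b) $\mathrm{SOL}(K,P+Q)$ is bounded for every $Q\in\mathcal{P}_{d-1}$; (c) for any bounded open set $\mathcal{O}\subset\mathcal{P}_{d-1}$, the set $S_{\mathcal{O}}:=\bigcup_{Q\in\mathcal{O}}\mathrm{SOL}(K,P+Q)$ is bounded. Then (a) $\Rightarrow$ (c) $\Rightarrow$ (b). Moreover, if $K$ is a cone, then the three statements are equivalent.
   Context: For a nonempty closed convex set $K\subset\mathbb{R}^n$ and a continuous map $F:\mathbb{R}^n\to\mathbb{R}^n$, $\mathrm{SOL}(K,F)$ denotes the solution set of the variational inequality: the set of $x\in K$ such that $\langle F(x),y-x\rangle\ge 0$ for all $y\in K$. A nonempty set $C$ is a cone if $\lambda>0$ and $x\in C$ imply $\lambda x\in C$. The asymptotic cone of $K$ is $K^\infty=\{v\in\mathbb{R}^n:\exists t_k\to\infty,\ \exists x_k\in K,\ x_k/t_k\to v\}$ (the recession cone of $K$). For a polynomial map $P=(P_1,\dots,P_n)$, its degree is $d=\max_l\deg P_l$, and $P^\infty=(P_1^\infty,\dots,P_n^\infty)$, where $P_l^\infty$ is the homogeneous component of degree $d$ of $P_l$. The pair $(K,P)$ is an $R_0$-pair if $\mathrm{SOL}(K^\infty,P^\infty)=\{0\}$. For an integer $e\ge 0$, $\mathcal{P}_e$ denotes the finite-dimensional vector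 space of polynomial maps $\mathbb{R}^n\to\mathbb{R}^n$ all of whose components have degree at most $e$, normed by the Frobenius norm of the matrix of coefficients. *)

theory Defs
  imports "HOL-Analysis.Analysis" "HOL-Library.Poly_Mapping"
begin

text \<open>
  A real polynomial in the variables indexed by the finite type \<open>'n\<close> is a finitely supported
  coefficient function on monomials, a monomial being its exponent vector. A polynomial map
  on \<open>real ^ 'n\<close> is a vector of such polynomials; sums and differences of polynomial
  maps are those of the library types.
\<close>

type_synonym 'n monomial = "'n \<Rightarrow>\<^sub>0 nat"
type_synonym 'n polynomial = "'n monomial \<Rightarrow>\<^sub>0 real"
type_synonym 'n polymap = "('n polynomial) ^ 'n"

abbreviation "lookup \<equiv> Poly_Mapping.lookup"
abbreviation "keys \<equiv> Poly_Mapping.keys"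

definition mon_degree :: "'n::finite monomial \<Rightarrow> nat" where
  "mon_degree m = (\<Sum>i\<in>UNIV. lookup m i)"

definition poly_eval :: "'n::finite polynomial \<Rightarrow> real ^ 'n \<Rightarrow> real" where
  "poly_eval p x = (\<Sum>m\<in>keys p. lookup p m * (\<Prod>i\<in>UNIV. (x $ i) ^ lookup m i))"

definition polymap_eval :: "'n::finite polymap \<Rightarrow> real ^ 'n \<Rightarrow> real ^ 'n" where
  "polymap_eval P x = (\<chi> l. poly_eval (P $ l) x)"

text \<open>The zero polynomial is given degree \<open>0\<close>.\<close>

definition poly_degree :: "'n::finite polynomial \<Rightarrow> nat" where
  "poly_degree p = Max (insert 0 (mon_degree ` keys p))"

definition polymap_degree :: "'n::finite polymap \<Rightarrow> nat" where
  "polymap_degree P = Max (range (\<lambda>l. poly_degree (P $ l)))"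

definition hom_component :: "nat \<Rightarrow> 'n::finite polynomial \<Rightarrow> 'n polynomial" where
  "hom_component k p =
     (\<Sum>m \<in> {m \<in> keys p. mon_degree m = k}. Poly_Mapping.single m (lookup p m))"

text \<open>
  Every component contributes its part of degree \<open>polymap_degree P\<close>, which
  vanishes if that component has smaller degree.
\<close>

definition leading_part :: "'n::finite polymap \<Rightarrow> 'n polymap" where
  "leading_part P = (\<chi> l. hom_component (polymap_degree P) (P $ l))"

definition polymaps_upto :: "nat \<Rightarrow> ('n::finite polymap) set" where
  "polymaps_upto e = {Q. \<forall>l. poly_degree (Q $ l) \<le> e}"

text \<open>Entries of the coefficient matrix outside \<open>keys\<close> are zero and can be left out of the sum.\<close>

definition frobenius_norm :: "'n::finite polymap \<Rightarrow> real" where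
  "frobenius_norm Q = sqrt (\<Sum>l\<in>UNIV. \<Sum>m\<in>keys (Q $ l). (lookup (Q $ l) m)\<^sup>2)"

definition frobenius_dist :: "'n::finite polymap \<Rightarrow> 'n polymap \<Rightarrow> real" where
  "frobenius_dist Q R = frobenius_norm (Q - R)"

definition SOL :: "(real ^ 'n::finite) set \<Rightarrow> (real ^ 'n \<Rightarrow> real ^ 'n) \<Rightarrow> (real ^ 'n) set" where
  "SOL K F = {x \<in> K. \<forall>y\<in>K. F x \<bullet> (y - x) \<ge> 0}"

text \<open>
  Unlike the library's \<^const>\<open>cone\<close>, this asks for closure under positive scalars only
  and excludes the empty set.
\<close>

definition is_cone :: "(real ^ 'n::finite) set \<Rightarrow> bool" where
  "is_cone C \<longleftrightarrow> C \<noteq> {} \<and> (\<forall>c>0. \<forall>x\<in>C. c *\<^sub>R x \<in> C)"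

definition asymptotic_cone :: "(real ^ 'n::finite) set \<Rightarrow> (real ^ 'n) set" where
  "asymptotic_cone K =
     {v. \<exists>(t :: nat \<Rightarrow> real) x. filterlim t at_top sequentially \<and> (\<forall>k. x k \<in> K) \<and>
           (\<lambda>k. x k /\<^sub>R t k) \<longlonglongrightarrow> v}"

definition R0_pair :: "(real ^ 'n::finite) set \<Rightarrow> 'n polymap \<Rightarrow> bool" where
  "R0_pair K P \<longleftrightarrow> SOL (asymptotic_cone K) (polymap_eval (leading_part P)) = {0}"

lemma poly_eval_superset:
  assumes "finite A" "keys p \<subseteq> A"
  shows "poly_eval p x = (\<Sum>m\<in>A. lookup p m * (\<Prod>i\<in>UNIV. (x $ i) ^ lookup m i))"
  unfolding poly_eval_def using assms
  by (intro sum.mono_neutral_left) (auto simp: in_keys_iff)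

lemma polymap_eval_add:
  fixes P Q :: "'n::finite polymap"
  shows "polymap_eval (P + Q) x = polymap_eval P x + polymap_eval Q x"
proof -
  have "poly_eval (p + q) x = poly_eval p x + poly_eval q x" for p q :: "'n polynomial" and x
  proof -
    let ?A = "keys p \<union> keys q"
    have "keys (p + q) \<subseteq> ?A" by (rule Poly_Mapping.keys_add)
    then show ?thesis
      by (simp add: poly_eval_superset[of ?A] lookup_add distrib_right sum.distrib)
  qed
  then show ?thesis by (simp add: polymap_eval_def vec_eq_iff)
qed

lemma frobenius_norm_superset:
  assumes "finite A" "\<And>l. keys (Q $ l) \<subseteq> A"
  shows "frobenius_norm Q = L2_set (\<lambda>(l, m). lookup (Q $ l) m) (UNIV \<times> A)"
proof -
  have "(\<Sum>m\<in>keys (Q $ l). (lookup (Q $ l) m)\<^sup>2) = (\<Sum>m\<in>A. (lookup (Q $ l) m)\<^sup>2)" for l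
    using assms by (intro sum.mono_neutral_left) (auto simp: in_keys_iff)
  then show ?thesis
    by (simp add: frobenius_norm_def L2_set_def sum.cartesian_product case_prod_beta)
qed

lemma Metric_space_polymaps:
  "Metric_space (polymaps_upto e :: ('n::finite polymap) set) frobenius_dist"
proof
  fix P Q R :: "'n polymap"
  define A where "A = (\<Union>l. keys (P $ l) \<union> keys (Q $ l) \<union> keys (R $ l))"
  have fin: "finite A" by (simp add: A_def)
  have sub: "keys ((U - V) $ l) \<subseteq> A" if "U \<in> {P, Q, R}" "V \<in> {P, Q, R}" for U V l
    using that keys_diff[of "U $ l" "V $ l"] by (auto simp: A_def)
  have D: "frobenius_dist U V = L2_set (\<lambda>(l, m). lookup (U $ l) m - lookup (V $ l) m) (UNIV \<times> A)"
    if "U \<in> {P, Q, R}" "V \<in> {P, Q, R}" for U V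
    using frobenius_norm_superset[OF fin sub[OF that]]
    by (simp add: frobenius_dist_def lookup_minus)
  show "0 \<le> frobenius_dist P Q"
    by (simp add: D)
  show "frobenius_dist P Q = frobenius_dist Q P"
    by (simp add: D L2_set_def power2_commute case_prod_beta)
  show "frobenius_dist P Q = 0 \<longleftrightarrow> P = Q"
  proof
    assume "frobenius_dist P Q = 0"
    then have eq: "lookup (P $ l) m = lookup (Q $ l) m" if "m \<in> A" for l m
      using that fin by (simp add: D L2_set_eq_0_iff case_prod_beta)
    have "lookup (P $ l) m = lookup (Q $ l) m" for l m
      using eq[of m l] by (cases "m \<in> A") (auto simp: A_def in_keys_iff)
    then show "P = Q" by (simp add: vec_eq_iff poly_mapping_eqI)
  qed (simp add: D L2_set_def)
  have "frobenius_dist P R = L2_set (\<lambda>z. (\<lambda>(l, m). lookup (P $ l) m - lookup (Q $ l) m) z +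
          (\<lambda>(l, m). lookup (Q $ l) m - lookup (R $ l) m) z) (UNIV \<times> A)"
    by (simp add: D case_prod_beta')
  also have "\<dots> \<le> frobenius_dist P Q + frobenius_dist Q R"
    using L2_set_triangle_ineq by (simp add: D)
  finally show "frobenius_dist P R \<le> frobenius_dist P Q + frobenius_dist Q R" .
qed

end

theory Submission
  imports Defs
begin

text \<open>
  Write \<open>G\<close> for the evaluation of the leading part of \<open>P\<close>. It is homogeneous of degree \<open>d\<close>,
  and \<open>P + Q\<close> differs from it by a polynomial map of degree below \<open>d\<close>, whose size at a point of
  norm \<open>r \<ge> 1\<close> is at most a constant times its Frobenius norm times \<open>r ^ (d - 1)\<close>
  (\<open>polymap_eval_growth\<close>).

  From (a) to (c): if solutions \<open>x k\<close> for perturbations from a bounded set escape to infinity,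
  their directions accumulate at a unit vector \<open>v\<close>. After division by \<open>norm (x k) ^ (d + 1)\<close> the
  perturbations disappear from the variational inequality at \<open>x k\<close>. The test points
  \<open>u + norm (x k) *\<^sub>R y\<close>, with \<open>u\<close> in \<open>K\<close> and \<open>y\<close> an asymptotic direction, lie in the closed convex set \<open>K\<close>,
  so in the limit \<open>v\<close> is a nonzero solution for \<open>G\<close> on the asymptotic cone
  (\<open>SOL_asymptotic_limit\<close>), against (a).

  From (c) to (b): every \<open>Q\<close> lies in a ball, which is open and bounded.

  From (b) to (a) on a cone: \<open>K\<close> is its own asymptotic cone, and \<open>Q\<close> can be chosen so that
  \<open>P + Q\<close> is exactly the leading part. By homogeneity the solutions for \<open>G\<close> on \<open>K\<close> form
  a cone, so their boundedness excludes nonzero ones.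
\<close>

section \<open>Degrees and coefficients\<close>

lemma poly_degree_le_iff:
  "poly_degree p \<le> e \<longleftrightarrow> (\<forall>m. lookup p m \<noteq> 0 \<longrightarrow> mon_degree m \<le> e)"
  unfolding poly_degree_def by (auto simp: in_keys_iff)

lemma polymaps_upto_iff:
  "Q \<in> polymaps_upto e \<longleftrightarrow> (\<forall>l m. lookup (Q $ l) m \<noteq> 0 \<longrightarrow> mon_degree m \<le> e)"
  unfolding polymaps_upto_def by (auto simp: poly_degree_le_iff)

lemma polymaps_upto_polymap_degree: "P \<in> polymaps_upto (polymap_degree P)"
  unfolding polymaps_upto_def polymap_degree_def by auto

lemma lookup_hom_component:
  "lookup (hom_component k p) m = (if mon_degree m = k then lookup p m else 0)"
  unfolding hom_component_def
  by (auto simp: lookup_sum lookup_single when_def in_keys_iff)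

lemma leading_part_diff_degree:
  assumes "polymap_degree P > 0"
  shows "leading_part P - P \<in> polymaps_upto (polymap_degree P - 1)"
  using assms polymaps_upto_polymap_degree[of P]
  unfolding polymaps_upto_iff
  by (auto simp: leading_part_def lookup_minus lookup_hom_component split: if_splits)
     (metis Suc_pred le_neq_implies_less less_Suc_eq_le)

lemma polymaps_upto_diff:
  assumes "Q \<in> polymaps_upto e" "R \<in> polymaps_upto e"
  shows "Q - R \<in> polymaps_upto e"
  using assms unfolding polymaps_upto_iff
  by (metis diff_self lookup_minus vector_minus_component)

lemma finite_mon_degree_le: "finite {m :: 'n::finite monomial. mon_degree m \<le> e}"
proof (rule finite_imageD)
  have "lookup m i \<le> mon_degree m" for m :: "'n monomial" and i
    unfolding mon_degree_def by (rule member_le_sum) auto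
  then have "lookup ` {m :: 'n monomial. mon_degree m \<le> e} \<subseteq> (\<Pi>\<^sub>E i\<in>UNIV. {..e})"
    by (auto simp: PiE_UNIV_domain intro: order_trans)
  then show "finite (lookup ` {m :: 'n monomial. mon_degree m \<le> e})"
    by (rule finite_subset) (simp add: finite_PiE)
  show "inj_on lookup {m :: 'n monomial. mon_degree m \<le> e}"
    by (simp add: inj_on_def poly_mapping_eqI)
qed

section \<open>Growth of polynomial maps\<close>

lemma abs_lookup_le_frobenius_norm: "\<bar>lookup (Q $ l) m\<bar> \<le> frobenius_norm Q"
proof -
  define A where "A = insert m (\<Union>l. keys (Q $ l))"
  have fin: "finite A" and sub: "\<And>l. keys (Q $ l) \<subseteq> A" by (auto simp: A_def)
  have "\<bar>lookup (Q $ l) m\<bar> = \<bar>(\<lambda>(l, m). lookup (Q $ l) m) (l, m)\<bar>" by simp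
  also have "\<dots> \<le> L2_set (\<lambda>z. \<bar>(\<lambda>(l, m). lookup (Q $ l) m) z\<bar>) (UNIV \<times> A)"
    using fin by (intro member_le_L2_set) (auto simp: A_def)
  also have "\<dots> = frobenius_norm Q"
    using frobenius_norm_superset[OF fin sub] by (simp add: L2_set_def)
  finally show ?thesis .
qed

lemma abs_monomial_le:
  fixes x :: "real ^ 'n::finite"
  assumes "norm x \<ge> 1" "mon_degree m \<le> e"
  shows "\<bar>\<Prod>i\<in>UNIV. (x $ i) ^ lookup m i\<bar> \<le> norm x ^ e"
proof -
  have "\<bar>\<Prod>i\<in>UNIV. (x $ i) ^ lookup m i\<bar> = (\<Prod>i\<in>UNIV. \<bar>x $ i\<bar> ^ lookup m i)"
    by (simp add: abs_prod power_abs)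
  also have "\<dots> \<le> (\<Prod>i\<in>UNIV. norm x ^ lookup m i)"
    by (intro prod_mono conjI power_mono component_le_norm_cart) auto
  also have "\<dots> = norm x ^ mon_degree m"
    by (simp add: mon_degree_def power_sum)
  also have "\<dots> \<le> norm x ^ e"
    using assms by (rule power_increasing[rotated])
  finally show ?thesis .
qed

text \<open>
  The constant counts the pairs of a component and a monomial of degree at most \<open>e\<close>. It is
  chosen before \<open>R\<close>, so the estimate is uniform over bounded sets of polynomial maps.
\<close>

lemma polymap_eval_growth:
  obtains C where "C \<ge> 0"
    "\<And>(R :: 'n::finite polymap) x. R \<in> polymaps_upto e \<Longrightarrow> norm x \<ge> 1 \<Longrightarrow>
       norm (polymap_eval R x) \<le> C * frobenius_norm R * norm x ^ e"
proof
  define M where "M = {m :: 'n monomial. mon_degree m \<le> e}"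
  define C where "C = real CARD('n) * real (card M)"
  have finM: "finite M" unfolding M_def by (rule finite_mon_degree_le)
  show "C \<ge> 0" by (simp add: C_def)
  fix R :: "'n polymap" and x :: "real ^ 'n"
  assume R: "R \<in> polymaps_upto e" and x: "norm x \<ge> 1"
  have comp: "\<bar>poly_eval (R $ l) x\<bar> \<le> real (card M) * (frobenius_norm R * norm x ^ e)" for l
  proof -
    have "keys (R $ l) \<subseteq> M"
      using R by (auto simp: M_def polymaps_upto_iff in_keys_iff)
    then have "\<bar>poly_eval (R $ l) x\<bar>
        \<le> (\<Sum>m\<in>M. \<bar>lookup (R $ l) m * (\<Prod>i\<in>UNIV. (x $ i) ^ lookup m i)\<bar>)"
      using finM by (simp add: poly_eval_superset)
    also have "\<dots> \<le> (\<Sum>m\<in>M. frobenius_norm R * norm x ^ e)"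
      unfolding abs_mult
      using x by (intro sum_mono mult_mono abs_lookup_le_frobenius_norm abs_monomial_le)
        (auto simp: M_def intro: order_trans[OF abs_ge_zero abs_lookup_le_frobenius_norm])
    finally show ?thesis by simp
  qed
  have "norm (polymap_eval R x) \<le> (\<Sum>l\<in>UNIV. \<bar>poly_eval (R $ l) x\<bar>)"
    using norm_le_l1_cart[of "polymap_eval R x"] by (simp add: polymap_eval_def)
  also have "\<dots> \<le> (\<Sum>l\<in>(UNIV :: 'n set). real (card M) * (frobenius_norm R * norm x ^ e))"
    by (intro sum_mono comp)
  finally show "norm (polymap_eval R x) \<le> C * frobenius_norm R * norm x ^ e"
    by (simp add: C_def mult.assoc)
qed

lemma polymap_eval_leading_part_scaleR:
  "polymap_eval (leading_part P) (c *\<^sub>R x)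
     = c ^ polymap_degree P *\<^sub>R polymap_eval (leading_part P) x"
proof -
  have "poly_eval (hom_component k p) (c *\<^sub>R x) = c ^ k * poly_eval (hom_component k p) x"
    for k and p :: "'a polynomial"
    unfolding poly_eval_def sum_distrib_left
  proof (rule sum.cong)
    fix m assume "m \<in> keys (hom_component k p)"
    then have "(\<Sum>i\<in>UNIV. lookup m i) = k"
      by (auto simp: in_keys_iff lookup_hom_component mon_degree_def split: if_splits)
    then show "lookup (hom_component k p) m * (\<Prod>i\<in>UNIV. ((c *\<^sub>R x) $ i) ^ lookup m i)
        = c ^ k * (lookup (hom_component k p) m * (\<Prod>i\<in>UNIV. (x $ i) ^ lookup m i))"
      by (auto simp: power_mult_distrib prod.distrib simp flip: power_sum)
  qed simp
  then show ?thesis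
    by (simp add: polymap_eval_def leading_part_def vec_eq_iff)
qed

lemma continuous_on_polymap_eval: "continuous_on UNIV (polymap_eval Q)"
  unfolding polymap_eval_def poly_eval_def by (intro continuous_intros)

section \<open>Asymptotic cones\<close>

text \<open>
  If \<open>z k /\<^sub>R t k\<close> tends to \<open>y\<close>, then \<open>u + s *\<^sub>R y\<close> is the limit of the convex
  combinations of \<open>u\<close> and \<open>z k\<close> that give weight \<open>s / t k\<close> to \<open>z k\<close>.
\<close>

lemma asymptotic_cone_translate:
  assumes "closed K" "convex K" "u \<in> K" "y \<in> asymptotic_cone K" "s \<ge> 0"
  shows "u + s *\<^sub>R y \<in> K"
proof -
  from assms(4) obtain t z where t: "filterlim t at_top sequentially"
    and z: "\<And>k. z k \<in> K" and lim: "(\<lambda>k. z k /\<^sub>R t k) \<longlonglongrightarrow> y"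
    unfolding asymptotic_cone_def by blast
  define p where "p k = (1 - s / t k) *\<^sub>R u + (s / t k) *\<^sub>R z k" for k
  have "(\<lambda>k. s / t k) \<longlonglongrightarrow> 0"
    using t by (rule real_tendsto_divide_at_top[OF tendsto_const])
  then have "(\<lambda>k. (1 - s / t k) *\<^sub>R u + s *\<^sub>R (z k /\<^sub>R t k)) \<longlonglongrightarrow> (1 - 0) *\<^sub>R u + s *\<^sub>R y"
    using lim by (intro tendsto_intros)
  then have "p \<longlonglongrightarrow> u + s *\<^sub>R y"
    by (simp add: p_def[abs_def] divide_inverse)
  moreover have "eventually (\<lambda>k. p k \<in> K) sequentially"
    using filterlim_at_top_dense[THEN iffD1, OF t, rule_format, of s]
  proof eventually_elim
    case (elim k)
    then show ?case
      unfolding p_def using assms z by (intro convexD) auto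
  qed
  ultimately show ?thesis
    using assms(1) by (intro Lim_in_closed_set[where f = p]) auto
qed

lemma zero_mem_asymptotic_cone:
  assumes "K \<noteq> {}"
  shows "0 \<in> asymptotic_cone K"
proof -
  obtain u where "u \<in> K" using assms by blast
  moreover have "(\<lambda>k. u /\<^sub>R real k) \<longlonglongrightarrow> 0 *\<^sub>R u"
    by (intro tendsto_intros lim_inverse_n)
  ultimately show ?thesis
    unfolding asymptotic_cone_def using filterlim_real_sequentially by fastforce
qed

lemma asymptotic_cone_of_cone:
  assumes "closed K" "is_cone K"
  shows "asymptotic_cone K = K"
proof (intro equalityI subsetI)
  fix v assume "v \<in> asymptotic_cone K"
  then obtain t x where t: "filterlim t at_top sequentially"
    and x: "\<And>k. x k \<in> K" and lim: "(\<lambda>k. x k /\<^sub>R t k) \<longlonglongrightarrow> v"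
    unfolding asymptotic_cone_def by blast
  have "eventually (\<lambda>k. x k /\<^sub>R t k \<in> K) sequentially"
    using filterlim_at_top_dense[THEN iffD1, OF t, rule_format, of 0]
    by eventually_elim (use assms(2) x in \<open>auto simp: is_cone_def\<close>)
  then show "v \<in> K"
    using assms(1) lim by (intro Lim_in_closed_set[where f = "\<lambda>k. x k /\<^sub>R t k"]) auto
next
  fix v assume v: "v \<in> K"
  have "filterlim (\<lambda>k. real (Suc k)) at_top sequentially"
    using filterlim_real_sequentially by (rule filterlim_compose) (rule filterlim_Suc)
  moreover have "real (Suc k) *\<^sub>R v \<in> K" for k
    using assms(2) v unfolding is_cone_def by (meson of_nat_0_less_iff zero_less_Suc)
  moreover have "(\<lambda>k. (real (Suc k) *\<^sub>R v) /\<^sub>R real (Suc k)) \<longlonglongrightarrow> v"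
    by (simp del: of_nat_Suc)
  ultimately show "v \<in> asymptotic_cone K"
    unfolding asymptotic_cone_def
    by (intro CollectI exI[of _ "\<lambda>k. real (Suc k)"] exI[of _ "\<lambda>k. real (Suc k) *\<^sub>R v"] conjI allI)
qed

section \<open>Solutions escaping to infinity\<close>

text \<open>
  For \<open>u\<close> in \<open>K\<close> and \<open>y\<close> in the asymptotic cone, test the variational inequality at \<open>x k\<close> with
  \<open>u + norm (x k) *\<^sub>R y\<close> and divide by \<open>norm (x k) ^ (d + 1)\<close>. The contribution of \<open>u\<close> vanishes
  in the limit, which leaves the inequality for \<open>g\<close> at \<open>v\<close> tested with \<open>y\<close>.
\<close>

lemma SOL_asymptotic_limit:
  fixes x :: "nat \<Rightarrow> real ^ 'n::finite"
  assumes K: "K \<noteq> {}" "closed K" "convex K"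
    and sol: "\<And>k. x k \<in> SOL K (F k)"
    and inf: "filterlim (\<lambda>k. norm (x k)) at_top sequentially"
    and dir: "(\<lambda>k. x k /\<^sub>R norm (x k)) \<longlonglongrightarrow> v"
    and val: "(\<lambda>k. F k (x k) /\<^sub>R norm (x k) ^ d) \<longlonglongrightarrow> G v"
  shows "v \<in> SOL (asymptotic_cone K) G"
  unfolding SOL_def
proof (intro CollectI conjI ballI)
  have xK: "x k \<in> K" for k using sol[of k] by (simp add: SOL_def)
  show "v \<in> asymptotic_cone K"
    unfolding asymptotic_cone_def using inf xK dir by blast
  fix y assume y: "y \<in> asymptotic_cone K"
  obtain u where u: "u \<in> K" using K by blast
  have "(\<lambda>k. inverse (norm (x k))) \<longlonglongrightarrow> 0"
    using inf by (rule tendsto_inverse_0_at_top)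
  then have "(\<lambda>k. (F k (x k) /\<^sub>R norm (x k) ^ d) \<bullet>
      (u /\<^sub>R norm (x k) + y - x k /\<^sub>R norm (x k))) \<longlonglongrightarrow> G v \<bullet> (0 *\<^sub>R u + y - v)"
    using val dir by (intro tendsto_intros)
  moreover have "eventually (\<lambda>k. (F k (x k) /\<^sub>R norm (x k) ^ d) \<bullet>
      (u /\<^sub>R norm (x k) + y - x k /\<^sub>R norm (x k)) \<ge> 0) sequentially"
    using filterlim_at_top_dense[THEN iffD1, OF inf, rule_format, of 0]
  proof eventually_elim
    case (elim k)
    have "u + norm (x k) *\<^sub>R y \<in> K"
      using K u y by (intro asymptotic_cone_translate) auto
    then have ge: "F k (x k) \<bullet> (u + norm (x k) *\<^sub>R y - x k) \<ge> 0"
      using sol[of k] by (simp add: SOL_def)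
    have "u /\<^sub>R norm (x k) + y - x k /\<^sub>R norm (x k)
        = (u + norm (x k) *\<^sub>R y - x k) /\<^sub>R norm (x k)"
      using elim by (simp add: algebra_simps)
    then show ?case using ge by simp
  qed
  ultimately have "G v \<bullet> (0 *\<^sub>R u + y - v) \<ge> 0"
    by (intro tendsto_lowerbound) auto
  then show "G v \<bullet> (y - v) \<ge> 0" by simp
qed

lemma SOL_scaleR_homogeneous:
  assumes "is_cone K" and hom: "\<And>c x. G (c *\<^sub>R x) = c ^ d *\<^sub>R G x"
    and "x \<in> SOL K G" "c > 0"
  shows "c *\<^sub>R x \<in> SOL K G"
  unfolding SOL_def
proof (intro CollectI conjI ballI)
  show "c *\<^sub>R x \<in> K" using assms by (auto simp: SOL_def is_cone_def)
  fix y assume "y \<in> K"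
  then have "y /\<^sub>R c \<in> K" using assms by (auto simp: is_cone_def)
  then have "G x \<bullet> (y /\<^sub>R c - x) \<ge> 0" using assms by (simp add: SOL_def)
  moreover have "G (c *\<^sub>R x) \<bullet> (y - c *\<^sub>R x) = c ^ Suc d * (G x \<bullet> (y /\<^sub>R c - x))"
    using \<open>c > 0\<close> by (simp add: hom inner_diff_right field_simps)
  ultimately show "G (c *\<^sub>R x) \<bullet> (y - c *\<^sub>R x) \<ge> 0"
    using \<open>c > 0\<close> by simp
qed

text \<open>
  The remainders \<open>Q k - (leading_part P - P)\<close> have bounded Frobenius norms and degree
  below that of \<open>P\<close>, so only the leading part survives the scaling.
\<close>

lemma leading_part_asymptotic_limit:
  fixes x :: "nat \<Rightarrow> real ^ 'n::finite" and P :: "'n polymap"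
  assumes d: "d > 0" "polymap_degree P = d"
    and Q: "\<And>k. Q k \<in> polymaps_upto (d - 1)"
    and B: "\<And>k. frobenius_norm (Q k - (leading_part P - P)) \<le> B"
    and inf: "filterlim (\<lambda>k. norm (x k)) at_top sequentially"
    and dir: "(\<lambda>k. x k /\<^sub>R norm (x k)) \<longlonglongrightarrow> v"
  shows "(\<lambda>k. polymap_eval (P + Q k) (x k) /\<^sub>R norm (x k) ^ d)
           \<longlonglongrightarrow> polymap_eval (leading_part P) v"
proof -
  define R where "R k = Q k - (leading_part P - P)" for k
  let ?L = "polymap_eval (leading_part P)"
  have R: "R k \<in> polymaps_upto (d - 1)" for k
    unfolding R_def
    by (rule polymaps_upto_diff[OF Q]) (use leading_part_diff_degree[of P] d in simp)
  obtain C where C: "C \<ge> 0" "\<And>(R :: 'n polymap) x. R \<in> polymaps_upto (d - 1) \<Longrightarrow> norm x \<ge> 1 \<Longrightarrow>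
       norm (polymap_eval R x) \<le> C * frobenius_norm R * norm x ^ (d - 1)"
    by (rule polymap_eval_growth[where e = "d - 1"]) blast
  have big: "eventually (\<lambda>k. norm (x k) > 1) sequentially"
    using inf by (simp add: filterlim_at_top_dense)
  have "(\<lambda>k. polymap_eval (R k) (x k) /\<^sub>R norm (x k) ^ d) \<longlonglongrightarrow> 0"
  proof (rule Lim_null_comparison)
    show "eventually (\<lambda>k. norm (polymap_eval (R k) (x k) /\<^sub>R norm (x k) ^ d)
        \<le> C * B * inverse (norm (x k))) sequentially"
      using big
    proof eventually_elim
      case (elim k)
      have "norm (polymap_eval (R k) (x k)) \<le> C * frobenius_norm (R k) * norm (x k) ^ (d - 1)"
        using C(2)[OF R] elim by simp
      also have "\<dots> \<le> C * B * norm (x k) ^ (d - 1)"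
        using B C(1) by (intro mult_right_mono mult_left_mono) (auto simp: R_def)
      finally have "norm (polymap_eval (R k) (x k)) * inverse (norm (x k) ^ d)
          \<le> C * B * norm (x k) ^ (d - 1) * inverse (norm (x k) ^ d)"
        by (rule mult_right_mono) simp
      also have "norm (x k) ^ (d - 1) * inverse (norm (x k) ^ d) = inverse (norm (x k))"
      proof (cases d)
        case (Suc e)
        then show ?thesis using elim by (simp add: field_simps)
      qed (use d in simp)
      then have "C * B * norm (x k) ^ (d - 1) * inverse (norm (x k) ^ d)
          = C * B * inverse (norm (x k))"
        by (metis mult.assoc)
      finally show ?case
        by (simp add: mult.commute)
    qed
    have "(\<lambda>k. C * B * inverse (norm (x k))) \<longlonglongrightarrow> C * B * 0"
      using inf by (intro tendsto_intros tendsto_inverse_0_at_top)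
    then show "(\<lambda>k. C * B * inverse (norm (x k))) \<longlonglongrightarrow> 0" by simp
  qed
  moreover have "(\<lambda>k. ?L (x k /\<^sub>R norm (x k))) \<longlonglongrightarrow> ?L v"
    by (rule continuous_on_tendsto_compose[OF continuous_on_polymap_eval dir]) auto
  ultimately have "(\<lambda>k. ?L (x k /\<^sub>R norm (x k)) + polymap_eval (R k) (x k) /\<^sub>R norm (x k) ^ d)
      \<longlonglongrightarrow> ?L v + 0"
    by (intro tendsto_add)
  moreover have "?L (x k /\<^sub>R norm (x k)) + polymap_eval (R k) (x k) /\<^sub>R norm (x k) ^ d
      = polymap_eval (P + Q k) (x k) /\<^sub>R norm (x k) ^ d" for k
  proof -
    have "P + Q k = leading_part P + R k" by (simp add: R_def)
    then have "polymap_eval (P + Q k) (x k) = ?L (x k) + polymap_eval (R k) (x k)"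
      by (metis polymap_eval_add)
    then show ?thesis
      by (simp add: polymap_eval_leading_part_scaleR d scaleR_add_right power_inverse)
  qed
  ultimately show ?thesis by simp
qed

lemma R0_pair_imp_bounded_solutions:
  fixes K :: "(real ^ 'n::finite) set" and P :: "'n polymap"
  assumes K: "K \<noteq> {}" "closed K" "convex K"
    and d: "d > 0" "polymap_degree P = d"
    and R0: "R0_pair K P"
    and bdd: "Metric_space.mbounded (polymaps_upto (d - 1)) frobenius_dist \<O>"
  shows "bounded (\<Union>Q\<in>\<O>. SOL K (polymap_eval (P + Q)))"
proof (rule ccontr)
  interpret Metric_space "polymaps_upto (d - 1) :: 'n polymap set" frobenius_dist
    by (rule Metric_space_polymaps)
  (* P + Q = leading_part P + (Q - T), so the bound needed is one on Q - T. *)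
  define T where "T = leading_part P - P"
  have T: "T \<in> polymaps_upto (d - 1)"
    using leading_part_diff_degree[of P] d by (simp add: T_def)
  from bdd obtain Q0 B where ball: "\<O> \<subseteq> mcball Q0 B"
    unfolding mbounded_def by blast
  have B: "Q \<in> polymaps_upto (d - 1) \<and> frobenius_norm (Q - T) \<le> B + frobenius_dist Q0 T"
    if "Q \<in> \<O>" for Q
  proof -
    have Q: "Q0 \<in> polymaps_upto (d - 1)" "Q \<in> polymaps_upto (d - 1)" "frobenius_dist Q0 Q \<le> B"
      using subsetD[OF ball that] by (simp_all add: in_mcball del: One_nat_def)
    then have "frobenius_dist Q T \<le> frobenius_dist Q0 Q + frobenius_dist Q0 T"
      using triangle[OF Q(2,1) T] commute[of Q Q0] by linarith
    then show ?thesis using Q by (simp add: frobenius_dist_def)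
  qed
  assume "\<not> bounded (\<Union>Q\<in>\<O>. SOL K (polymap_eval (P + Q)))"
  then have "\<forall>k::nat. \<exists>x Q. Q \<in> \<O> \<and> x \<in> SOL K (polymap_eval (P + Q)) \<and> norm x > real k"
    unfolding bounded_iff by (auto simp: not_le) blast
  then obtain x Q where Q: "\<And>k. Q k \<in> \<O>"
    and sol: "\<And>k. x k \<in> SOL K (polymap_eval (P + Q k))"
    and big: "\<And>k::nat. norm (x k) > real k"
    by metis
  have inf: "filterlim (\<lambda>k. norm (x k)) at_top sequentially"
    using filterlim_real_sequentially
    by (rule filterlim_at_top_mono) (simp add: big less_imp_le)
  have "\<forall>k. x k /\<^sub>R norm (x k) \<in> sphere 0 1"
  proof
    fix k
    have "norm (x k) > 0"
      using big[of k] by (rule le_less_trans[rotated]) simp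
    then show "x k /\<^sub>R norm (x k) \<in> sphere 0 1" by simp
  qed
  then obtain v r where v: "v \<in> sphere 0 1" and r: "strict_mono r"
    and dir: "((\<lambda>k. x k /\<^sub>R norm (x k)) \<circ> r) \<longlonglongrightarrow> v"
    by (rule seq_compactE[OF compact_imp_seq_compact[OF compact_sphere]])
  have inf': "filterlim (\<lambda>k. norm (x (r k))) at_top sequentially"
    using filterlim_compose[OF inf filterlim_subseq[OF r]] .
  have dir': "(\<lambda>k. x (r k) /\<^sub>R norm (x (r k))) \<longlonglongrightarrow> v"
    using dir by (simp add: o_def)
  have "(\<lambda>k. polymap_eval (P + Q (r k)) (x (r k)) /\<^sub>R norm (x (r k)) ^ d)
      \<longlonglongrightarrow> polymap_eval (leading_part P) v"
    by (rule leading_part_asymptotic_limit[OF d _ _ inf' dir', of _ "B + frobenius_dist Q0 T"])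
      (use B[OF Q] in \<open>auto simp: T_def\<close>)
  with K sol inf' dir' have "v \<in> SOL (asymptotic_cone K) (polymap_eval (leading_part P))"
    by (intro SOL_asymptotic_limit[where x = "x \<circ> r" and F = "\<lambda>k. polymap_eval (P + Q (r k))"])
      (auto simp: o_def)
  then have "v = 0" using R0 by (simp add: R0_pair_def)
  then show False using v by simp
qed

section \<open>Cones\<close>

lemma bounded_SOL_imp_R0_pair:
  fixes K :: "(real ^ 'n::finite) set" and P :: "'n polymap"
  assumes "closed K" "is_cone K" and d: "polymap_degree P > 0"
    and bdd: "bounded (SOL K (polymap_eval (leading_part P)))"
  shows "R0_pair K P"
proof -
  let ?L = "polymap_eval (leading_part P)"
  have K: "asymptotic_cone K = K" using assms by (intro asymptotic_cone_of_cone)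
  have "0 \<in> K"
    using zero_mem_asymptotic_cone[of K] assms(2) unfolding K by (auto simp: is_cone_def)
  moreover have "?L 0 = 0"
    using polymap_eval_leading_part_scaleR[of P 0 0] d by (simp add: power_0_left)
  ultimately have "0 \<in> SOL K ?L" by (simp add: SOL_def)
  moreover have "v = 0" if v: "v \<in> SOL K ?L" for v
  proof (rule ccontr)
    assume "v \<noteq> 0"
    obtain B where B: "B > 0" "\<And>x. x \<in> SOL K ?L \<Longrightarrow> norm x \<le> B"
      using bdd unfolding bounded_pos by blast
    (* This multiple of v has norm B + 1. *)
    have "((B + 1) / norm v) *\<^sub>R v \<in> SOL K ?L"
      using \<open>is_cone K\<close> polymap_eval_leading_part_scaleR v
      by (rule SOL_scaleR_homogeneous) (use B(1) \<open>v \<noteq> 0\<close> in simp)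
    from B(2)[OF this] show False using B(1) \<open>v \<noteq> 0\<close> by simp
  qed
  ultimately show ?thesis unfolding R0_pair_def K by blast
qed

theorem proposition3p1:
  fixes K :: "(real ^ 'n) set" and P :: "'n polymap" and d :: nat
  assumes "K \<noteq> {}" and "closed K" and "convex K"
    and "d > 0" and "polymap_degree P = d"
  shows
    "let a = R0_pair K P;
         b = (\<forall>Q \<in> polymaps_upto (d - 1). bounded (SOL K (polymap_eval (P + Q))));
         c = (\<forall>\<O>. openin (Metric_space.mtopology (polymaps_upto (d - 1)) frobenius_dist) \<O> \<and>
                  Metric_space.mbounded (polymaps_upto (d - 1)) frobenius_dist \<O> \<longrightarrow>
                  bounded (\<Union>Q\<in>\<O>. SOL K (polymap_eval (P + Q))))
     in (a \<longrightarrow> c) \<and> (c \<longrightarrow> b) \<and> (is_cone K \<longrightarrow> (a \<longleftrightarrow> b) \<and> (b \<longleftrightarrow> c))"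
proof -
  interpret Metric_space "polymaps_upto (d - 1) :: 'n polymap set" frobenius_dist
    by (rule Metric_space_polymaps)
  define b where "b \<longleftrightarrow> (\<forall>Q \<in> polymaps_upto (d - 1). bounded (SOL K (polymap_eval (P + Q))))"
  define c where "c \<longleftrightarrow> (\<forall>\<O>. openin mtopology \<O> \<and> mbounded \<O> \<longrightarrow>
      bounded (\<Union>Q\<in>\<O>. SOL K (polymap_eval (P + Q))))"
  have ac: c if "R0_pair K P"
    unfolding c_def using R0_pair_imp_bounded_solutions[OF assms that] by blast
  have cb: b if c
    unfolding b_def
  proof
    fix Q :: "'n polymap" assume Q: "Q \<in> polymaps_upto (d - 1)"
    have "bounded (\<Union>Q\<in>mball Q 1. SOL K (polymap_eval (P + Q)))"
      using \<open>c\<close>[unfolded c_def, rule_format, OF conjI, OF openin_mball mbounded_mball] .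
    then show "bounded (SOL K (polymap_eval (P + Q)))"
      by (rule bounded_subset) (rule UN_upper, simp add: Q del: One_nat_def)
  qed
  have ba: "R0_pair K P" if b "is_cone K"
  proof (rule bounded_SOL_imp_R0_pair)
    have "leading_part P - P \<in> polymaps_upto (d - 1)"
      using leading_part_diff_degree[of P] assms by simp
    then have "bounded (SOL K (polymap_eval (P + (leading_part P - P))))"
      using \<open>b\<close> unfolding b_def by blast
    then show "bounded (SOL K (polymap_eval (leading_part P)))" by simp
  qed (use assms that in auto)
  show ?thesis
    unfolding Let_def b_def[symmetric] c_def[symmetric] using ac cb ba by blast
qed

end
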